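(* Let $A,B,C_1,\dots,C_m\in\mathbb{C}^{n\times n}$, $r_i,s_i\in\mathbb{C}^n$ and $g_i\in\mathbb{C}^n\setminus\{0\}$ for $i=1,\dots,m$, and put $f_i(x)=\frac{r_i^Tx}{s_i^Tx}$. Assume $(\lambda,\mu_1,\dots,\mu_m,x_1,\dots,x_{m+1})$ is a solution of the multiparameter eigenvalue problem $$\begin{aligned}-Ax_1&=(\lambda B+\mu_1C_1+\cdots+\mu_mC_m)x_1,\\ -(A+g_jr_j^T)x_{j+1}&=\bigl(\lambda B+\mu_1C_1+\cdots+\mu_mC_m-\mu_jg_js_j^T\bigr)x_{j+1},\qquad j=1,\dots,m,\end{aligned}$$ and let $(\lambda,\mu_1,\dots,\mu_m,y_1,\dots,y_{m+1})$, with the same $\lambda,\mu_1,\dots,\mu_m$, be a solution of the transposed problem $$\begin{aligned}-A^Ty_1&=(\lambda B^T+\mu_1C_1^T+\cdots+\mu_mC_m^T)y_1,\\ -(A^T+r_jg_j^T)y_{j+1}&=\bigl(\lambda B^T+\mu_1C_1^T+\cdots+\mu_mC_m^T-\mu_js_jg_j^T\bigr)y_{j+1},\qquad j=1,\dots,m.\end{aligned}$$ If $s_j^Tx_1\neq0$ and $g_j^Ty_{j+1}\neq0$ for all $j=1,\dots,m$, then $(\lambda,x_1)$ is a solution of the NEPv $$(A+\lambda B+f_1(x)C_1+\cdots+f_m(x)C_m)x=0.$$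
   Context: A solution of the NEPv is a pair $(\lambda,x)$ with $\lambda\in\mathbb{C}$, $x\in\mathbb{C}^n\setminus\{0\}$ and $s_i^Tx\ne0$ for all $i$ satisfying the NEPv equation. A solution of either multiparameter eigenvalue problem is a tuple consisting of scalars $\lambda,\mu_1,\dots,\mu_m\in\mathbb{C}$ and $m+1$ nonzero vectors in $\mathbb{C}^n$ that satisfies all $m+1$ equations. The superscript $T$ denotes transpose without conjugation. *)

theory Defs
  imports "HOL-Analysis.Analysis"
begin

text \<open>
  Families indexed by \<open>1, \<dots>, m\<close> (or \<open>1, \<dots>, m + 1\<close>) are functions on \<^typ>\<open>nat\<close>, of which only
  the values in that range matter. The transpose never conjugates, so \<open>u\<^sup>T v\<close> is
  \<^const>\<open>scalar_product\<close>, not the inner product.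
\<close>

definition smult_mat :: "complex \<Rightarrow> complex^'n^'n \<Rightarrow> complex^'n^'n" (infixr \<open>*\<^sub>M\<close> 75)
  where "c *\<^sub>M M = map_matrix (\<lambda>z. c * z) M"

definition outer :: "complex^'n \<Rightarrow> complex^'n \<Rightarrow> complex^'n^'n"
  where "outer u v = (columnvector u :: complex^1^'n) ** (rowvector v :: complex^'n^1)"

definition ratio :: "(nat \<Rightarrow> complex^'n) \<Rightarrow> (nat \<Rightarrow> complex^'n) \<Rightarrow> nat \<Rightarrow> complex^'n \<Rightarrow> complex"
  where "ratio r s i x = scalar_product (r i) x / scalar_product (s i) x"

definition nepv_solution ::
  "nat \<Rightarrow> complex^'n^'n \<Rightarrow> complex^'n^'n \<Rightarrow> (nat \<Rightarrow> complex^'n^'n)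
    \<Rightarrow> (nat \<Rightarrow> complex^'n) \<Rightarrow> (nat \<Rightarrow> complex^'n) \<Rightarrow> complex \<Rightarrow> complex^'n \<Rightarrow> bool"
  where "nepv_solution m A B C r s lam x \<longleftrightarrow>
    x \<noteq> 0 \<and> (\<forall>i\<in>{1..m}. scalar_product (s i) x \<noteq> 0) \<and>
    (A + lam *\<^sub>M B + (\<Sum>i=1..m. ratio r s i x *\<^sub>M C i)) *v x = 0"

definition mep_solution ::
  "nat \<Rightarrow> complex^'n^'n \<Rightarrow> complex^'n^'n \<Rightarrow> (nat \<Rightarrow> complex^'n^'n)
    \<Rightarrow> (nat \<Rightarrow> complex^'n) \<Rightarrow> (nat \<Rightarrow> complex^'n) \<Rightarrow> (nat \<Rightarrow> complex^'n)
    \<Rightarrow> complex \<Rightarrow> (nat \<Rightarrow> complex) \<Rightarrow> (nat \<Rightarrow> complex^'n) \<Rightarrow> bool"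
  where "mep_solution m A B C r s g lam mu x \<longleftrightarrow>
    (\<forall>i\<in>{1..m+1}. x i \<noteq> 0) \<and>
    (- A) *v x 1 = (lam *\<^sub>M B + (\<Sum>i=1..m. mu i *\<^sub>M C i)) *v x 1 \<and>
    (\<forall>j\<in>{1..m}. (- (A + outer (g j) (r j))) *v x (j+1) =
      (lam *\<^sub>M B + (\<Sum>i=1..m. mu i *\<^sub>M C i) - mu j *\<^sub>M outer (g j) (s j)) *v x (j+1))"

definition transposed_mep_solution ::
  "nat \<Rightarrow> complex^'n^'n \<Rightarrow> complex^'n^'n \<Rightarrow> (nat \<Rightarrow> complex^'n^'n)
    \<Rightarrow> (nat \<Rightarrow> complex^'n) \<Rightarrow> (nat \<Rightarrow> complex^'n) \<Rightarrow> (nat \<Rightarrow> complex^'n)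
    \<Rightarrow> complex \<Rightarrow> (nat \<Rightarrow> complex) \<Rightarrow> (nat \<Rightarrow> complex^'n) \<Rightarrow> bool"
  where "transposed_mep_solution m A B C r s g lam mu y \<longleftrightarrow>
    (\<forall>i\<in>{1..m+1}. y i \<noteq> 0) \<and>
    (- transpose A) *v y 1 =
      (lam *\<^sub>M transpose B + (\<Sum>i=1..m. mu i *\<^sub>M transpose (C i))) *v y 1 \<and>
    (\<forall>j\<in>{1..m}. (- (transpose A + outer (r j) (g j))) *v y (j+1) =
      (lam *\<^sub>M transpose B + (\<Sum>i=1..m. mu i *\<^sub>M transpose (C i))
        - mu j *\<^sub>M outer (s j) (g j)) *v y (j+1))"

end

theory Submission
  imports Defs
begin

text \<open>
  Write \<open>M = A + \<lambda> B + \<mu>\<^sub>1 C\<^sub>1 + \<dots> + \<mu>\<^sub>m C\<^sub>m\<close>. The first equation of the multiparameter problem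
  is \<open>M x\<^sub>1 = 0\<close>, so it is already the desired equation once \<open>\<mu>\<^sub>j = f\<^sub>j(x\<^sub>1)\<close> is known for
  every \<open>j\<close>. This is what the transposed problem provides. Both rank-one corrections in its equation
  for \<open>y\<^sub>j\<^sub>+\<^sub>1\<close> have \<open>g\<^sub>j\<^sup>T\<close> as their right factor, so that equation says
  \<open>M\<^sup>T y\<^sub>j\<^sub>+\<^sub>1 = - (g\<^sub>j\<^sup>T y\<^sub>j\<^sub>+\<^sub>1) (r\<^sub>j - \<mu>\<^sub>j s\<^sub>j)\<close>. As \<open>g\<^sub>j\<^sup>T y\<^sub>j\<^sub>+\<^sub>1\<close> is nonzero, \<open>r\<^sub>j - \<mu>\<^sub>j s\<^sub>j\<close> lies in the
  range of \<open>M\<^sup>T\<close>, and the range of \<open>M\<^sup>T\<close> annihilates the kernel of \<open>M\<close>. Hence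
  \<open>r\<^sub>j\<^sup>T x\<^sub>1 = \<mu>\<^sub>j s\<^sub>j\<^sup>T x\<^sub>1\<close>, and division by \<open>s\<^sub>j\<^sup>T x\<^sub>1\<close> gives the claim
  (lemma \<open>mu_eq_quotient_on_kernel\<close>).
\<close>

lemma scalar_product_add_left:
  "scalar_product (u + v) w = scalar_product u w + scalar_product v w"
  by (simp add: scalar_product_def sum.distrib algebra_simps)

lemma scalar_product_diff_left:
  fixes u v w :: "'a::comm_ring_1^'n"
  shows "scalar_product (u - v) w = scalar_product u w - scalar_product v w"
  by (simp add: scalar_product_def sum_subtractf algebra_simps)

lemma scalar_product_smult_left:
  fixes u w :: "'a::comm_semiring_1^'n"
  shows "scalar_product (c *s u) w = c * scalar_product u w"
  by (simp add: scalar_product_def sum_distrib_left mult.assoc)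

lemma scalar_product_zero [simp]:
  "scalar_product 0 (w :: 'a::semiring_1^'n) = 0"
  "scalar_product w 0 = 0"
  by (simp_all add: scalar_product_def)

lemma scalar_product_transpose_mult:
  fixes M :: "'a::comm_semiring_1^'n^'n"
  shows "scalar_product (transpose M *v y) x = scalar_product y (M *v x)"
proof -
  have "scalar_product (transpose M *v y) x = (\<Sum>i\<in>UNIV. \<Sum>k\<in>UNIV. M $ k $ i * y $ k * x $ i)"
    by (simp add: scalar_product_def matrix_vector_mult_def transpose_def sum_distrib_right)
  also have "\<dots> = (\<Sum>k\<in>UNIV. \<Sum>i\<in>UNIV. M $ k $ i * y $ k * x $ i)"
    by (rule sum.swap)
  also have "\<dots> = scalar_product y (M *v x)"
    by (simp add: scalar_product_def matrix_vector_mult_def sum_distrib_left ac_simps)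
  finally show ?thesis .
qed

lemma outer_mult_vector: "outer u v *v w = scalar_product v w *s u"
  by (simp add: vec_eq_iff outer_def scalar_product_def matrix_vector_mult_def
      matrix_matrix_mult_def columnvector_def rowvector_def sum_distrib_left
      sum_distrib_right ac_simps)

lemma smult_mat_mult_vector: "(c *\<^sub>M M) *v v = c *s (M *v v)"
  by (simp add: vec_eq_iff smult_mat_def map_matrix_def matrix_vector_mult_def
      sum_distrib_left ac_simps)

lemma transpose_add: "transpose (M + N) = transpose M + transpose N"
  by (simp add: vec_eq_iff transpose_def)

lemma transpose_smult_mat: "transpose (c *\<^sub>M M) = c *\<^sub>M transpose M"
  by (simp add: vec_eq_iff transpose_def smult_mat_def map_matrix_def)

lemma transpose_sum: "transpose (\<Sum>i\<in>I. M i) = (\<Sum>i\<in>I. transpose (M i))"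
  by (simp add: vec_eq_iff transpose_def)

text \<open>
  If \<open>M\<^sup>T y + (g\<^sup>T y) (r - \<mu> s) = 0\<close> and \<open>M x = 0\<close>, multiplying the first equation by \<open>x\<^sup>T\<close> kills
  \<open>M\<^sup>T y\<close> and leaves \<open>(g\<^sup>T y) (r\<^sup>T x - \<mu> s\<^sup>T x) = 0\<close>.
\<close>

lemma mu_eq_quotient_on_kernel:
  fixes M :: "'a::field^'n^'n"
  assumes kernel: "M *v x = 0"
    and left: "transpose M *v y + scalar_product g y *s (r - \<mu> *s s) = 0"
    and "scalar_product g y \<noteq> 0" and "scalar_product s x \<noteq> 0"
  shows "\<mu> = scalar_product r x / scalar_product s x"
proof -
  have "0 = scalar_product (transpose M *v y + scalar_product g y *s (r - \<mu> *s s)) x"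
    by (simp only: left scalar_product_zero)
  also have "\<dots> = scalar_product g y * (scalar_product r x - \<mu> * scalar_product s x)"
    by (simp only: scalar_product_add_left scalar_product_diff_left scalar_product_smult_left
        scalar_product_transpose_mult kernel scalar_product_zero add_0)
  finally have "scalar_product r x = \<mu> * scalar_product s x"
    using assms(3) by simp
  then show ?thesis
    using assms(4) by simp
qed

theorem theorem3p4:
  fixes A B :: "complex^'n^'n" and C :: "nat \<Rightarrow> complex^'n^'n"
    and r s g :: "nat \<Rightarrow> complex^'n" and m :: nat
    and lam :: complex and mu :: "nat \<Rightarrow> complex" and x y :: "nat \<Rightarrow> complex^'n"
  assumes "\<forall>i\<in>{1..m}. g i \<noteq> 0"
    and "mep_solution m A B C r s g lam mu x"
    and "transposed_mep_solution m A B C r s g lam mu y"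
    and "\<forall>j\<in>{1..m}. scalar_product (s j) (x 1) \<noteq> 0"
    and "\<forall>j\<in>{1..m}. scalar_product (g j) (y (j+1)) \<noteq> 0"
  shows "nepv_solution m A B C r s lam (x 1)"
proof -
  define P where "P = lam *\<^sub>M B + (\<Sum>i=1..m. mu i *\<^sub>M C i)"
  have transpose_P: "transpose P = lam *\<^sub>M transpose B + (\<Sum>i=1..m. mu i *\<^sub>M transpose (C i))"
    by (simp add: P_def transpose_add transpose_smult_mat transpose_sum)
  have "x 1 \<noteq> 0" and first_equation: "(- A) *v x 1 = P *v x 1"
    using assms(2) by (auto simp: mep_solution_def P_def)
  have minus_mult: "(- M) *v v = - (M *v v)" for M :: "complex^'n^'n" and v
    using matrix_vector_mult_diff_rdistrib[of 0 M v] by simp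
  have kernel: "(A + P) *v x 1 = 0"
    using first_equation
    by (metis add.right_inverse matrix_vector_mult_add_rdistrib minus_mult)
  have mu_eq: "mu j = ratio r s j (x 1)" if j: "j \<in> {1..m}" for j
  proof -
    have "(- (transpose A + outer (r j) (g j))) *v y (j+1)
        = (transpose P - mu j *\<^sub>M outer (s j) (g j)) *v y (j+1)"
      using assms(3) j unfolding transposed_mep_solution_def transpose_P by blast
    then have "- (transpose A *v y (j+1) + scalar_product (g j) (y (j+1)) *s r j)
        = transpose P *v y (j+1) - mu j *s (scalar_product (g j) (y (j+1)) *s s j)"
      by (simp only: minus_mult matrix_vector_mult_add_rdistrib matrix_vector_mult_diff_rdistrib
          outer_mult_vector smult_mat_mult_vector)
    then have "transpose (A + P) *v y (j+1)
        + scalar_product (g j) (y (j+1)) *s (r j - mu j *s s j) = 0"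
      by (simp add: transpose_add matrix_vector_mult_add_rdistrib vec_eq_iff algebra_simps
          minus_equation_iff)
    then show ?thesis
      unfolding ratio_def
      using mu_eq_quotient_on_kernel[OF kernel] assms(4,5) j by blast
  qed
  have "(\<Sum>i=1..m. ratio r s i (x 1) *\<^sub>M C i) = (\<Sum>i=1..m. mu i *\<^sub>M C i)"
    by (rule sum.cong) (simp_all add: mu_eq)
  then have "(A + lam *\<^sub>M B + (\<Sum>i=1..m. ratio r s i (x 1) *\<^sub>M C i)) *v x 1 = 0"
    using kernel by (simp add: P_def add.assoc)
  with \<open>x 1 \<noteq> 0\<close> assms(4) show ?thesis
    by (simp add: nepv_solution_def)
qed

end
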